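(* Let $0<q<1$ and let $p>1$ be a fixed real number. Then $$P_q^*(x)\sim \frac{x\log p}{\log\left(\frac{1}{1-q}\right)}\qquad (x\to\infty),$$ that is, the ratio of the two sides tends to $1$ as the real variable $x$ tends to $\infty$.
   Context: $N=\{1,2,3,\dots\}$ denotes the set of positive integers. For $0<q<1$, the $q$-gamma function is $$\Gamma_q(x)=\frac{(q;q)_\infty}{(q^x;q)_\infty}(1-q)^{1-x},\qquad (a;q)_\infty=\prod_{n=0}^\infty(1-aq^n).$$ For $0<q<1$, real $p>1$ and real $x\in[1,\infty)$ define $$P_q^*(x)=\max\{m\in N:\ \Gamma_q(m+1)\le p^x\}.$$ *)

theory Defs
  imports "HOL-Analysis.Analysis" "HOL-Library.Landau_Symbols"
begin

definition qpochhammer_inf :: "real \<Rightarrow> real \<Rightarrow> real" where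
  "qpochhammer_inf a q = (\<Prod>n. 1 - a * q ^ n)"

definition q_Gamma :: "real \<Rightarrow> real \<Rightarrow> real" where
  "q_Gamma q x =
     qpochhammer_inf q q / qpochhammer_inf (q powr x) q * (1 - q) powr (1 - x)"

(* Max is only meaningful on finite nonempty sets. For 0 < q < 1, p > 1 and x >= 1 the set
   below contains 1, since q_Gamma q 2 = 1, and it is finite, since q_Gamma q (m + 1) is the
   product of the numbers (1 - q^k) / (1 - q) for 1 <= k <= m and hence tends to infinity. *)
definition P_star :: "real \<Rightarrow> real \<Rightarrow> real \<Rightarrow> nat" where
  "P_star q p x = Max {m :: nat. 1 \<le> m \<and> q_Gamma q (real m + 1) \<le> p powr x}"

end

theory Submission
  imports Defs
begin

text \<open>
  The value of the q-gamma function at m + 1 is L^m times c / (q^(m+1); q)_inf, where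
  L = 1 / (1 - q) and c = (q; q)_inf. The second factor lies between c and 1, so m belongs to
  the set defining P*(x) when m ln L \<le> x ln p, and only if m ln L \<le> x ln p - ln c.
  Hence P*(x) differs from x ln p / ln L by a bounded amount.
\<close>

text \<open>The deviations of the factors from 1 form a geometric series, so the product converges
  absolutely.\<close>

lemma convergent_prod_qpochhammer:
  fixes a q :: real
  assumes "0 < q" "q < 1"
  shows "convergent_prod (\<lambda>n. 1 - a * q ^ n)"
proof -
  have "summable (\<lambda>n. norm (- a * q ^ n))"
    using assms by (simp add: abs_mult power_abs summable_mult summable_geometric)
  then have "abs_convergent_prod (\<lambda>n. 1 + - a * q ^ n)"
    by (subst abs_convergent_prod_conv_summable) simp_all
  from abs_convergent_prod_imp_convergent_prod[OF this] show ?thesis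
    by simp
qed

lemma qpochhammer_factor_pos:
  fixes a q :: real
  assumes "0 < q" "q < 1" "0 \<le> a" "a < 1"
  shows "0 < 1 - a * q ^ n"
proof -
  have "a * q ^ n \<le> a * 1"
    using assms by (intro mult_left_mono power_le_one) auto
  with assms show ?thesis by linarith
qed

text \<open>The comparison is factor by factor, with all factors positive because
  \<open>b < 1\<close>. Taking \<open>a = 0\<close> bounds the product by 1; taking
  \<open>b = q\<close> bounds the denominator of the q-gamma function from below.\<close>

lemma qpochhammer_inf_antimono:
  assumes q: "0 < q" "q < 1" and "0 \<le> a" "a \<le> b" "b < 1"
  shows "qpochhammer_inf b q \<le> qpochhammer_inf a q"
  unfolding qpochhammer_inf_def
proof (rule prodinf_le)
  show "(\<lambda>n. 1 - b * q ^ n) has_prod (\<Prod>n. 1 - b * q ^ n)"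
       "(\<lambda>n. 1 - a * q ^ n) has_prod (\<Prod>n. 1 - a * q ^ n)"
    using convergent_prod_qpochhammer[OF q] by (simp_all add: convergent_prod_has_prod)
  fix n
  show "0 \<le> 1 - b * q ^ n \<and> 1 - b * q ^ n \<le> 1 - a * q ^ n"
    using qpochhammer_factor_pos[of q b n] assms by (simp add: mult_right_mono)
qed

lemma qpochhammer_inf_le_1:
  assumes "0 < q" "q < 1" "0 \<le> a" "a < 1"
  shows "qpochhammer_inf a q \<le> 1"
  using qpochhammer_inf_antimono[of q 0 a] assms by (simp add: qpochhammer_inf_def)

text \<open>The relation \<open>has_prod\<close> admits the value 0 only when some factor vanishes,
  so positive factors force a positive product.\<close>

lemma qpochhammer_inf_pos:
  assumes "0 < q" "q < 1" "0 \<le> a" "a < 1"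
  shows "0 < qpochhammer_inf a q"
  unfolding qpochhammer_inf_def
  using convergent_prod_has_prod[OF convergent_prod_qpochhammer] qpochhammer_factor_pos
  by (rule has_prod_pos) (use assms in auto)

lemma q_Gamma_Suc_bounds:
  assumes q: "0 < q" "q < 1"
  shows "qpochhammer_inf q q * (1 / (1 - q)) ^ m \<le> q_Gamma q (real m + 1)"
    and "q_Gamma q (real m + 1) \<le> (1 / (1 - q)) ^ m"
proof -
  define c d where "c = qpochhammer_inf q q" and "d = qpochhammer_inf (q ^ Suc m) q"
  have "q powr (real m + 1) = q ^ Suc m"
    using q by (simp add: powr_add powr_realpow)
  moreover have "(1 - q) powr (1 - (real m + 1)) = (1 / (1 - q)) ^ m"
    using q by (simp add: powr_minus powr_realpow power_one_over inverse_eq_divide)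
  ultimately have eq: "q_Gamma q (real m + 1) = c / d * (1 / (1 - q)) ^ m"
    by (simp add: q_Gamma_def c_def d_def)
  have le: "q ^ Suc m \<le> q"
    using q power_le_one[of q m] by (simp add: mult_left_le)
  have "0 < c"
    using qpochhammer_inf_pos[of q q] q by (simp add: c_def)
  moreover have "c \<le> d"
    using qpochhammer_inf_antimono[of q "q ^ Suc m" q] q le by (simp add: c_def d_def)
  moreover have "d \<le> 1"
    unfolding d_def using q le_less_trans[OF le] by (intro qpochhammer_inf_le_1) simp_all
  \<comment> \<open>The first inequality comes from \<open>d \<le> 1\<close>, the second from
    \<open>c \<le> d\<close>.\<close>
  ultimately have "c \<le> c / d" "c / d \<le> 1"
    by (simp_all add: pos_le_divide_eq pos_divide_le_eq mult_left_le)
  moreover have "0 \<le> (1 / (1 - q)) ^ m"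
    using q by simp
  ultimately have "c * (1 / (1 - q)) ^ m \<le> c / d * (1 / (1 - q)) ^ m"
    and "c / d * (1 / (1 - q)) ^ m \<le> 1 * (1 / (1 - q)) ^ m"
    by (blast intro: mult_right_mono)+
  then show "qpochhammer_inf q q * (1 / (1 - q)) ^ m \<le> q_Gamma q (real m + 1)"
    and "q_Gamma q (real m + 1) \<le> (1 / (1 - q)) ^ m"
    by (simp_all only: eq c_def mult_1)
qed

text \<open>The hypothesis \<open>x\<close> ensures that the floor of \<open>x * ln p / l\<close> is
  at least 1, hence an admissible candidate for the maximum.\<close>

lemma P_star_bounds:
  fixes q p x :: real
  defines "l \<equiv> ln (1 / (1 - q))"
  assumes q: "0 < q" "q < 1" and p: "p > 1" and x: "1 \<le> x * ln p / l"
  shows "x * ln p / l - 1 \<le> real (P_star q p x)"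
    and "real (P_star q p x) \<le> x * ln p / l - ln (qpochhammer_inf q q) / l"
proof -
  define S where "S = {m :: nat. 1 \<le> m \<and> q_Gamma q (real m + 1) \<le> p powr x}"
  define c where "c = qpochhammer_inf q q"
  define k where "k = nat \<lfloor>x * ln p / l\<rfloor>"
  have l: "0 < l"
    unfolding l_def using q by (intro ln_gt_zero) simp
  have c: "0 < c"
    using qpochhammer_inf_pos[of q q] q by (simp add: c_def)
  \<comment> \<open>In exponential form, comparing with \<open>p powr x\<close> becomes an
    inequality linear in \<open>m\<close>.\<close>
  have L: "(1 / (1 - q)) ^ m = exp (real m * l)" for m
    unfolding l_def exp_of_nat_mult using q by (subst exp_ln) simp_all
  have px: "p powr x = exp (x * ln p)"
    using p by (simp add: powr_def)
  \<comment> \<open>Proved for every member of \<open>S\<close>, this serves twice: it makes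
    \<open>S\<close> finite, and it then applies to the maximum itself.\<close>
  have upper: "real m \<le> x * ln p / l - ln c / l" if "m \<in> S" for m
  proof -
    have "c * exp (real m * l) \<le> exp (x * ln p)"
      using q_Gamma_Suc_bounds(1)[OF q, of m] that by (simp add: S_def c_def L px)
    then have "exp (ln c + real m * l) \<le> exp (x * ln p)"
      using c by (simp add: exp_add)
    then show ?thesis
      using l by (simp add: field_simps)
  qed
  have "finite S"
  proof (rule finite_subset)
    show "S \<subseteq> {..nat \<lfloor>x * ln p / l - ln c / l\<rfloor>}"
      using upper by (auto simp: le_nat_floor)
  qed simp
  have "real k \<le> x * ln p / l"
    using x by (simp add: k_def)
  then have "exp (real k * l) \<le> p powr x"
    using l by (simp add: px field_simps)
  moreover have "1 \<le> k"
    using x by (simp add: k_def le_nat_iff le_floor_iff)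
  ultimately have "k \<in> S"
    using q_Gamma_Suc_bounds(2)[OF q, of k] by (simp add: S_def L)
  have P: "P_star q p x = Max S"
    by (simp add: P_star_def S_def)
  have "k \<le> P_star q p x"
    unfolding P using \<open>finite S\<close> \<open>k \<in> S\<close> by simp
  \<comment> \<open>Rounding down loses less than 1.\<close>
  moreover have "x * ln p / l - 1 \<le> real k"
    using x unfolding k_def by linarith
  ultimately show "x * ln p / l - 1 \<le> real (P_star q p x)"
    by linarith
  have "P_star q p x \<in> S"
    unfolding P using \<open>finite S\<close> \<open>k \<in> S\<close> by (intro Max_in) auto
  then show "real (P_star q p x) \<le> x * ln p / l - ln (qpochhammer_inf q q) / l"
    using upper by (simp add: c_def)
qed

theorem theorem2p2:
  fixes q p :: real
  assumes "0 < q" and "q < 1" and "p > 1"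
  shows "(\<lambda>x::real. real (P_star q p x)) \<sim>[at_top] (\<lambda>x. x * ln p / ln (1 / (1 - q)))"
proof -
  define l where "l = ln (1 / (1 - q))"
  define K where "K = ln (qpochhammer_inf q q) / l"
  define f where "f = (\<lambda>x::real. x * ln p / l)"
  have "0 < l"
    unfolding l_def using assms by (intro ln_gt_zero) simp
  then have "0 < ln p / l"
    using assms by simp
  then have f: "filterlim f at_top at_top"
    using filterlim_at_top_mult_tendsto_pos[OF tendsto_const _ filterlim_ident]
    by (simp add: f_def flip: times_divide_eq_right)
  \<comment> \<open>The difference lies between \<open>-1\<close> and \<open>-K\<close>, and
    \<open>1 + \<bar>K\<bar>\<close> dominates both in absolute value.\<close>
  have "(\<lambda>x. real (P_star q p x) - f x) \<in> O(\<lambda>_. 1)"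
  proof (rule bigoI)
    have "eventually (\<lambda>x. 1 \<le> f x) at_top"
      using f by (simp add: filterlim_at_top)
    then show "eventually (\<lambda>x. norm (real (P_star q p x) - f x) \<le> (1 + \<bar>K\<bar>) * norm (1::real)) at_top"
    proof eventually_elim
      case (elim x)
      have "f x - 1 \<le> real (P_star q p x)" "real (P_star q p x) \<le> f x - K"
        using P_star_bounds[OF assms, of x] elim by (simp_all only: f_def l_def K_def)
      then show ?case
        by simp
    qed
  qed
  \<comment> \<open>A bounded error is negligible because \<open>f\<close> tends to
    infinity.\<close>
  also have "(\<lambda>_. 1) \<in> o(f)"
  proof (intro smalloI_tendsto tendsto_divide_0[OF tendsto_const])
    show "filterlim f at_infinity at_top"
      using f by (rule filterlim_at_top_imp_at_infinity)
    have "eventually (\<lambda>x. 0 < f x) at_top"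
      using f by (simp add: filterlim_at_top_dense)
    then show "eventually (\<lambda>x. f x \<noteq> 0) at_top"
      by eventually_elim simp
  qed
  finally have "(\<lambda>x. real (P_star q p x)) \<sim>[at_top] f"
    by (rule smallo_imp_asymp_equiv)
  then show ?thesis
    by (simp add: f_def l_def)
qed

end
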